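(* For every odd $m\ge3$, $H_m$ is quotient-critically irreducible. Its seven proper quotients (the quotients by the seven nonidentity congruences $\nabla,\alpha,\pi,\beta,\lambda,\mu,\nu$) form exactly five isomorphism types: $$H_m/\nabla,\quad H_m/\alpha\cong H_m/\beta,\quad H_m/\pi,\quad H_m/\lambda\cong H_m/\mu,\quad H_m/\nu.$$ For $m=5$, the numbers of associative binary reductions of these seven labelled quotients are: $1$ for $\nabla$, $1$ for $\alpha$, $2$ for $\pi$, $1$ for $\beta$, $1$ for $\lambda$, $1$ for $\mu$, and $1$ for $\nu$. The two reductions of the parity quotient $H_5/\pi$ are $x+y$ and $x+y+1$ on $\mathbb Z_2$ (with class $\{1,4\}$ identified with $0$ and class $\{2,3\}$ with $1$); the unique reductions of the other quotients are the operations $g_\theta$ whose Cayley tables are listed in the context.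
   Context: Let $X=\{1,2,3,4\}$, let $\epsilon:X\to\mathbb Z_2$ be given by $\epsilon(1)=\epsilon(4)=0$, $\epsilon(2)=\epsilon(3)=1$, and let $\eta:\mathbb Z_2\to X$ be $\eta(0)=4$, $\eta(1)=3$. For odd $m\ge3$, $H_m:X^m\to X$ is defined by: $H_m(x_1,\dots,x_m)=1$ if $x_1=\dots=x_m=1$; $=2$ if $x_1=\dots=x_m=2$; and $=\eta(\epsilon(x_1)+\dots+\epsilon(x_m))$ otherwise, with the sum taken in $\mathbb Z_2$. It is an associative $m$-ary operation. The congruences of $H_m$ are the identity $\Delta=1|2|3|4$ and the seven nonidentity equivalences (partitions written with blocks separated by bars) $\lambda=1|23|4$, $\mu=14|2|3$, $\nu=1|2|34$, $\alpha=134|2$, $\pi=14|23$, $\beta=1|234$, $\nabla=1234$. A binary reduction of an associative $m$-ary operation $F$ on a set $Y$ is an associative binary operation $g:Y^2\to Y$ with $F(y_1,\dots,y_m)=g(\cdots g(g(y_1,y_2),y_3)\cdots,y_m)$ for all $y_i\in Y$. $F$ is binary reducible if such a $g$ exists, and irreducible otherwise. An irreducible $m$-ary semigroup is quotient-critically irreducible if each quotient by a nonidentity congruence is binary reducible. Reductions of a labelled quotient are counted as operations on the set $X/\theta$ (not up to isomorphism). Isomorphism of quotients is isomorphism of $m$-ary algebras. Cayley tables of $g_\theta$: order the classes of $\theta$ as stated and label them $0,1,2$ in that order; the entry in row $i$, column $j$ (starting from $0$) is $g_\theta(i,j)$; rows are separated by semicolons. - $\nabla$: classes $1234$; table $(0)$.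 - $\alpha$: classes $134,\ 2$; table $(0\,0;\ 0\,1)$. - $\beta$: classes $1,\ 234$; table $(0\,1;\ 1\,1)$. - $\lambda$: classes $1,\ 23,\ 4$; table $(0\,1\,2;\ 1\,2\,1;\ 2\,1\,2)$. - $\mu$: classes $14,\ 2,\ 3$; table $(2\,0\,0;\ 0\,1\,2;\ 0\,2\,2)$. - $\nu$: classes $1,\ 2,\ 34$; table $(0\,2\,2;\ 2\,1\,2;\ 2\,2\,2)$. *)

theory Defs
  imports Main "HOL-Library.FuncSet" "HOL-Library.Z2"
begin

(* An m-ary operation on a carrier A is a function on lists; only its values on the lists of
   length m over A matter. *)

definition tuples :: "nat \<Rightarrow> 'a set \<Rightarrow> 'a list set" where
  "tuples m A = {xs. length xs = m \<and> set xs \<subseteq> A}"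

definition mary_semigroup :: "nat \<Rightarrow> 'a set \<Rightarrow> ('a list \<Rightarrow> 'a) \<Rightarrow> bool" where
  "mary_semigroup m A F \<longleftrightarrow>
     (\<forall>xs \<in> tuples m A. F xs \<in> A) \<and>
     (\<forall>ws \<in> tuples (2 * m - 1) A. \<forall>i < m. \<forall>j < m.
        F (take i ws @ F (take m (drop i ws)) # drop (i + m) ws) =
        F (take j ws @ F (take m (drop j ws)) # drop (j + m) ws))"

(* The extensional function space makes the elements exactly the operations A x A -> A, so that
   they can be counted. *)
definition binary_reductions ::
    "nat \<Rightarrow> 'a set \<Rightarrow> ('a list \<Rightarrow> 'a) \<Rightarrow> ('a \<times> 'a \<Rightarrow> 'a) set" where
  "binary_reductions m A F =
     {g \<in> A \<times> A \<rightarrow>\<^sub>E A.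
        (\<forall>x\<in>A. \<forall>y\<in>A. \<forall>z\<in>A. g (g (x, y), z) = g (x, g (y, z))) \<and>
        (\<forall>ys \<in> tuples m A. F ys = foldl (\<lambda>x y. g (x, y)) (hd ys) (tl ys))}"

definition binary_reducible :: "nat \<Rightarrow> 'a set \<Rightarrow> ('a list \<Rightarrow> 'a) \<Rightarrow> bool" where
  "binary_reducible m A F \<longleftrightarrow> (\<exists>g. g \<in> binary_reductions m A F)"

definition mary_congruence :: "nat \<Rightarrow> 'a set \<Rightarrow> ('a list \<Rightarrow> 'a) \<Rightarrow> ('a \<times> 'a) set \<Rightarrow> bool" where
  "mary_congruence m A F \<theta> \<longleftrightarrow>
     equiv A \<theta> \<and>
     (\<forall>xs \<in> tuples m A. \<forall>ys \<in> tuples m A.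
        list_all2 (\<lambda>x y. (x, y) \<in> \<theta>) xs ys \<longrightarrow> (F xs, F ys) \<in> \<theta>)"

(* The operation induced on A // \<theta>: for a congruence \<theta> all the sets in this union, one for each
   choice of representatives, are the same class. *)
definition quotient_op :: "('a \<times> 'a) set \<Rightarrow> ('a list \<Rightarrow> 'a) \<Rightarrow> 'a set list \<Rightarrow> 'a set" where
  "quotient_op \<theta> F Cs = (\<Union>xs \<in> listset Cs. \<theta> `` {F xs})"

definition quotient_critically_irreducible :: "nat \<Rightarrow> 'a set \<Rightarrow> ('a list \<Rightarrow> 'a) \<Rightarrow> bool" where
  "quotient_critically_irreducible m A F \<longleftrightarrow>
     mary_semigroup m A F \<and>
     \<not> binary_reducible m A F \<and>
     (\<forall>\<theta>. mary_congruence m A F \<theta> \<and> \<theta> \<noteq> Id_on A \<longrightarrow>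
        binary_reducible m (A // \<theta>) (quotient_op \<theta> F))"

definition mary_isomorphic ::
    "nat \<Rightarrow> 'a set \<Rightarrow> ('a list \<Rightarrow> 'a) \<Rightarrow> 'b set \<Rightarrow> ('b list \<Rightarrow> 'b) \<Rightarrow> bool" where
  "mary_isomorphic m A F B G \<longleftrightarrow>
     (\<exists>h. bij_betw h A B \<and> (\<forall>xs \<in> tuples m A. h (F xs) = G (map h xs)))"

definition X :: "nat set" where
  "X = {1, 2, 3, 4}"

definition eps :: "nat \<Rightarrow> bit" where
  "eps x = (if x = 2 \<or> x = 3 then 1 else 0)"

definition eta :: "bit \<Rightarrow> nat" where
  "eta b = (if b = 0 then 4 else 3)"

definition H :: "nat \<Rightarrow> nat list \<Rightarrow> nat" where
  "H m xs =
     (if xs = replicate m 1 then 1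
      else if xs = replicate m 2 then 2
      else eta (sum_list (map eps xs)))"

definition equiv_of_classes :: "'a set list \<Rightarrow> ('a \<times> 'a) set" where
  "equiv_of_classes cs = (\<Union>C \<in> set cs. C \<times> C)"

definition nabla_classes :: "nat set list" where "nabla_classes = [{1, 2, 3, 4}]"
definition alpha_classes :: "nat set list" where "alpha_classes = [{1, 3, 4}, {2}]"
definition pi_classes :: "nat set list" where "pi_classes = [{1, 4}, {2, 3}]"
definition beta_classes :: "nat set list" where "beta_classes = [{1}, {2, 3, 4}]"
definition lambda_classes :: "nat set list" where "lambda_classes = [{1}, {2, 3}, {4}]"
definition mu_classes :: "nat set list" where "mu_classes = [{1, 4}, {2}, {3}]"
definition nu_classes :: "nat set list" where "nu_classes = [{1}, {2}, {3, 4}]"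

definition cong_nabla :: "(nat \<times> nat) set" where "cong_nabla = equiv_of_classes nabla_classes"
definition cong_alpha :: "(nat \<times> nat) set" where "cong_alpha = equiv_of_classes alpha_classes"
definition cong_pi :: "(nat \<times> nat) set" where "cong_pi = equiv_of_classes pi_classes"
definition cong_beta :: "(nat \<times> nat) set" where "cong_beta = equiv_of_classes beta_classes"
definition cong_lambda :: "(nat \<times> nat) set" where "cong_lambda = equiv_of_classes lambda_classes"
definition cong_mu :: "(nat \<times> nat) set" where "cong_mu = equiv_of_classes mu_classes"
definition cong_nu :: "(nat \<times> nat) set" where "cong_nu = equiv_of_classes nu_classes"

definition listed_congruences :: "(nat \<times> nat) set set" where
  "listed_congruences =
     {cong_nabla, cong_alpha, cong_pi, cong_beta, cong_lambda, cong_mu, cong_nu}"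

definition H_quotients_isomorphic :: "nat \<Rightarrow> (nat \<times> nat) set \<Rightarrow> (nat \<times> nat) set \<Rightarrow> bool" where
  "H_quotients_isomorphic m \<theta> \<phi> \<longleftrightarrow>
     mary_isomorphic m (X // \<theta>) (quotient_op \<theta> (H m)) (X // \<phi>) (quotient_op \<phi> (H m))"

definition H_quotient_reductions ::
    "nat \<Rightarrow> (nat \<times> nat) set \<Rightarrow> (nat set \<times> nat set \<Rightarrow> nat set) set" where
  "H_quotient_reductions m \<theta> = binary_reductions m (X // \<theta>) (quotient_op \<theta> (H m))"

(* The operation f on the label set L, carried over to h ` L by a labelling h injective on L. *)
definition labelled_op :: "'l set \<Rightarrow> ('l \<Rightarrow> 'a) \<Rightarrow> ('l \<Rightarrow> 'l \<Rightarrow> 'l) \<Rightarrow> 'a \<times> 'a \<Rightarrow> 'a" where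
  "labelled_op L h f =
     (\<lambda>(x, y) \<in> h ` L \<times> h ` L. h (f (inv_into L h x) (inv_into L h y)))"

definition cayley_op :: "'a list \<Rightarrow> nat list list \<Rightarrow> 'a \<times> 'a \<Rightarrow> 'a" where
  "cayley_op cs T = labelled_op {..<length cs} (\<lambda>i. cs ! i) (\<lambda>i j. T ! i ! j)"

definition parity_class :: "bit \<Rightarrow> nat set" where
  "parity_class b = (if b = 0 then {1, 4} else {2, 3})"

definition parity_op :: "(bit \<Rightarrow> bit \<Rightarrow> bit) \<Rightarrow> nat set \<times> nat set \<Rightarrow> nat set" where
  "parity_op f = labelled_op UNIV parity_class f"

end

theory Submission
  imports Defs
begin

text \<open>Products in \<open>H\<^sub>m\<close> can be regrouped, so every \<open>H\<^sub>m\<close> with \<open>m\<close> odd is an iterate of \<open>H\<^sub>3\<close>.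
  A partition of \<open>X\<close> carrying a semigroup operation on its blocks that is compatible with \<open>H\<^sub>3\<close> is
  therefore a congruence of \<open>H\<^sub>m\<close> whose quotient is reducible, for all odd \<open>m\<close> at once.

  Irreducibility and uniqueness of reductions both rest on powers: if \<open>e\<^sup>m = e\<close> and \<open>a = e e\<close>, then
  \<open>e a\<^sup>m\<^sup>-\<^sup>1 = e\<^sup>2\<^sup>m\<^sup>-\<^sup>1 = e\<close>, which often forces \<open>e e = e\<close>. In \<open>X\<close> this makes \<open>1\<close> and \<open>2\<close> idempotent for
  any reduction, and then the products \<open>1\<^sup>m\<^sup>-\<^sup>1 2\<close> and \<open>1\<^sup>m\<^sup>-\<^sup>2 2 2\<close> would agree, while \<open>H\<^sub>m\<close> sends
  them to \<open>3\<close> and \<open>4\<close>. In a quotient, an idempotent \<open>e\<close> with \<open>e x = x\<close> determines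
  \<open>x y = e\<^sup>m\<^sup>-\<^sup>2 x y\<close>.

  Nonisomorphic quotients are separated by the number of elements together with the number of \<open>e\<close>
  such that \<open>F(e, \<dots>, e, y) = y\<close> for all \<open>y\<close>.\<close>

section \<open>Idempotents and uniqueness of binary reductions\<close>

text \<open>Membership in \<open>binary_reductions\<close> in curried form and without
  extensionality, so that multiplication tables and addition on bits can be used directly as total
  functions.\<close>

definition reduces :: "nat \<Rightarrow> 'a set \<Rightarrow> ('a list \<Rightarrow> 'a) \<Rightarrow> ('a \<Rightarrow> 'a \<Rightarrow> 'a) \<Rightarrow> bool" where
  "reduces m A F f \<longleftrightarrow>
     (\<forall>x\<in>A. \<forall>y\<in>A. f x y \<in> A) \<and>
     (\<forall>x\<in>A. \<forall>y\<in>A. \<forall>z\<in>A. f (f x y) z = f x (f y z)) \<and>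
     (\<forall>xs\<in>tuples m A. F xs = foldl f (hd xs) (tl xs))"

lemma binary_reductions_iff:
  "h \<in> binary_reductions m A F \<longleftrightarrow>
     h \<in> extensional (A \<times> A) \<and> reduces m A F (\<lambda>x y. h (x, y))"
  unfolding binary_reductions_def reduces_def PiE_def by auto

lemma foldl_closed:
  assumes "\<forall>x\<in>A. \<forall>y\<in>A. f x y \<in> A" "a \<in> A" "set xs \<subseteq> A"
  shows "foldl f a xs \<in> A"
  using assms(2,3) by (induction xs arbitrary: a) (use assms(1) in auto)

text \<open>Both sides are the product of y with 2n factors x. The left operand y must vary in the
  induction, since each step absorbs two factors x into it.\<close>

lemma foldl_replicate_square:
  assumes "\<forall>x\<in>A. \<forall>y\<in>A. f x y \<in> A" "\<forall>x\<in>A. \<forall>y\<in>A. \<forall>z\<in>A. f (f x y) z = f x (f y z)"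
    and "x \<in> A" "y \<in> A"
  shows "foldl f y (replicate n (f x x)) = foldl f (foldl f y (replicate n x)) (replicate n x)"
  using assms(4)
proof (induction n arbitrary: y)
  case (Suc n)
  have "foldl f (f (f y x) x) (replicate n (f x x)) =
      foldl f (f (f y x) x) (replicate n x @ replicate n x)"
    using Suc assms by simp
  \<comment> \<open>One factor x moves from the middle to the front, where the fold absorbs
    it.\<close>
  moreover have "replicate n x @ replicate (Suc n) x = x # replicate n x @ replicate n x"
    by (simp add: replicate_append_same flip: append_assoc)
  then have "foldl f (foldl f (f y x) (replicate n x)) (replicate (Suc n) x) =
      foldl f (f y x) (x # replicate n x @ replicate n x)"
    by (simp only: foldl_append[symmetric])
  ultimately show ?case
    using Suc assms by simp
qed simp

text \<open>With \<open>a = f e e\<close>, the value of F on e followed by m - 1 copies of a is the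
  power of e with exponent 2m - 1. Using twice that the m-th power of e is e collapses it to e, so
  \<open>ne\<close> leaves only \<open>a = e\<close>.\<close>

lemma reduces_idempotent:
  assumes f: "reduces m A F f" and "m > 0" "e \<in> A" "F (replicate m e) = e"
    and ne: "\<And>a. a \<in> A \<Longrightarrow> a \<noteq> e \<Longrightarrow> F (e # replicate (m - 1) a) \<noteq> e"
  shows "f e e = e"
proof (rule ccontr)
  assume "f e e \<noteq> e"
  obtain n where m: "m = Suc n" using \<open>m > 0\<close> gr0_implies_Suc by blast
  have e: "foldl f e (replicate n e) = e"
  proof -
    have "replicate m e \<in> tuples m A" using \<open>e \<in> A\<close> by (auto simp: tuples_def)
    then have "F (replicate m e) = foldl f (hd (replicate m e)) (tl (replicate m e))"
      using f unfolding reduces_def by blast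
    then show ?thesis using assms(4) by (simp add: m)
  qed
  have a: "f e e \<in> A" using f \<open>e \<in> A\<close> by (simp add: reduces_def)
  then have "e # replicate (m - 1) (f e e) \<in> tuples m A"
    using \<open>e \<in> A\<close> by (auto simp: tuples_def m)
  then have "F (e # replicate (m - 1) (f e e)) = foldl f e (replicate n (f e e))"
    using f by (auto simp: reduces_def m)
  also have "\<dots> = e"
    using f \<open>e \<in> A\<close> by (subst foldl_replicate_square[of A]) (auto simp: reduces_def e)
  finally show False using ne[OF a \<open>f e e \<noteq> e\<close>] by simp
qed

lemma foldl_replicate_idempotent: "f e e = e \<Longrightarrow> foldl f e (replicate n e) = e"
  by (induction n) auto

text \<open>A prefix of copies of an idempotent e folds to e, so products starting with e can be
  read off from F alone.\<close>

lemma reduces_idempotent_prefix: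
  assumes f: "reduces m A F f" and "m \<ge> 3" "e \<in> A" "x \<in> A" "f e e = e"
  shows "F (replicate (m - 1) e @ [x]) = f e x"
    and "y \<in> A \<Longrightarrow> F (replicate (m - 2) e @ [x, y]) = f (f e x) y"
proof -
  obtain n where m: "m = Suc (Suc (Suc n))"
    using \<open>m \<ge> 3\<close> that[of "m - 3"] by simp
  have fold: "F xs = foldl f (hd xs) (tl xs)" if "xs \<in> tuples m A" for xs
    using f that by (simp add: reduces_def)
  have "replicate (m - 1) e @ [x] \<in> tuples m A"
    using assms by (auto simp: tuples_def)
  from fold[OF this] show "F (replicate (m - 1) e @ [x]) = f e x"
    using assms(5) by (simp add: m foldl_replicate_idempotent)
  assume "y \<in> A"
  then have "replicate (m - 2) e @ [x, y] \<in> tuples m A"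
    using assms by (auto simp: tuples_def)
  from fold[OF this] show "F (replicate (m - 2) e @ [x, y]) = f (f e x) y"
    using assms(5) by (simp add: m foldl_replicate_idempotent)
qed

text \<open>For every reduction, e is idempotent and acts as a left identity on x, so the product of
  x and y is the value of F at m - 2 copies of e followed by x and y. The choice of e may depend on
  x.\<close>

lemma reduces_unique:
  assumes "reduces m A F f" "reduces m A F g" "m \<ge> 3" "x \<in> A" "y \<in> A"
    and "e \<in> A" "F (replicate m e) = e"
    and "\<And>a. a \<in> A \<Longrightarrow> a \<noteq> e \<Longrightarrow> F (e # replicate (m - 1) a) \<noteq> e"
    and "F (replicate (m - 1) e @ [x]) = x"
  shows "f x y = g x y"
proof -
  have "f' x y = F (replicate (m - 2) e @ [x, y])" if f': "reduces m A F f'" for f'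
  proof -
    have "m > 0" using assms(3) by simp
    then have e: "f' e e = e" by (rule reduces_idempotent[OF f' _ assms(6-8)])
    from reduces_idempotent_prefix[OF f' assms(3,6,4) e] assms(5,9) show ?thesis by simp
  qed
  from this[OF assms(1)] this[OF assms(2)] show ?thesis by simp
qed

section \<open>Left neutral elements as an isomorphism invariant\<close>

text \<open>If F has a binary reduction, these are the e whose power with exponent m - 1 is a left
  identity. The condition mentions F only, so it does not depend on a choice of reduction.\<close>

definition left_neutrals :: "nat \<Rightarrow> 'a set \<Rightarrow> ('a list \<Rightarrow> 'a) \<Rightarrow> 'a set" where
  "left_neutrals m A F = {e \<in> A. \<forall>y\<in>A. F (replicate (m - 1) e @ [y]) = y}"

text \<open>The bijection h carries left neutrals onto left neutrals. Pulling an equation back along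
  h uses injectivity on A, hence the assumption that F stays in A.\<close>

lemma card_left_neutrals_eq:
  assumes h: "bij_betw h A B" "\<And>xs. xs \<in> tuples m A \<Longrightarrow> h (F xs) = G (map h xs)"
    and F: "\<And>xs. xs \<in> tuples m A \<Longrightarrow> F xs \<in> A" and "m > 0"
  shows "card (left_neutrals m A F) = card (left_neutrals m B G)"
proof -
  have inj: "inj_on h A" and B: "B = h ` A" using h(1) by (auto simp: bij_betw_def)
  have "F (replicate (m - 1) e @ [y]) = y \<longleftrightarrow> G (replicate (m - 1) (h e) @ [h y]) = h y"
    if "e \<in> A" "y \<in> A" for e y
  proof -
    have t: "replicate (m - 1) e @ [y] \<in> tuples m A"
      using that \<open>m > 0\<close> by (auto simp: tuples_def)
    then have "h (F (replicate (m - 1) e @ [y])) = G (replicate (m - 1) (h e) @ [h y])"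
      by (simp add: h(2))
    then show ?thesis using inj_on_eq_iff[OF inj F[OF t] that(2)] by simp
  qed
  then have "left_neutrals m B G = h ` left_neutrals m A F"
    unfolding left_neutrals_def B by auto
  moreover have "inj_on h (left_neutrals m A F)"
    using inj by (rule inj_on_subset) (auto simp: left_neutrals_def)
  ultimately show ?thesis by (simp add: card_image)
qed

lemma mary_isomorphic_card_eq:
  assumes "mary_isomorphic m A F B G" "\<And>xs. xs \<in> tuples m A \<Longrightarrow> F xs \<in> A" "m > 0"
  shows "card A = card B" "card (left_neutrals m A F) = card (left_neutrals m B G)"
proof -
  from assms(1) obtain h where h: "bij_betw h A B" "\<forall>xs\<in>tuples m A. h (F xs) = G (map h xs)"
    by (auto simp: mary_isomorphic_def)
  show "card A = card B" using h(1) by (rule bij_betw_same_card)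
  show "card (left_neutrals m A F) = card (left_neutrals m B G)"
    by (rule card_left_neutrals_eq[OF h(1)]) (use h(2) assms(2,3) in auto)
qed

lemma binary_reducible_closed:
  assumes "binary_reducible m A F" "m > 0" "xs \<in> tuples m A"
  shows "F xs \<in> A"
proof -
  from assms(1) obtain f where "reduces m A F f"
    by (auto simp: binary_reducible_def binary_reductions_iff)
  moreover obtain y ys where "xs = y # ys"
    using assms(2,3) by (cases xs) (auto simp: tuples_def)
  ultimately show ?thesis
    using assms(3) by (auto simp: reduces_def tuples_def intro!: foldl_closed)
qed

lemma mary_isomorphic_refl: "mary_isomorphic m A F A F"
  unfolding mary_isomorphic_def by (rule exI[of _ id]) simp

lemma labelled_op_apply:
  assumes "inj_on h L" "i \<in> L" "j \<in> L"
  shows "labelled_op L h f (h i, h j) = h (f i j)"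
  using assms by (simp add: labelled_op_def)

lemma labelled_op_cong:
  assumes "\<And>i j. i \<in> L \<Longrightarrow> j \<in> L \<Longrightarrow> f i j = g i j"
  shows "labelled_op L h f = labelled_op L h g"
  unfolding labelled_op_def by (rule restrict_ext) (auto simp: assms inv_into_into)

lemma listset_eq: "listset Cs = {xs. list_all2 (\<in>) xs Cs}"
  by (induction Cs) (auto simp: set_Cons_def list_all2_Cons2)

section \<open>Quotients presented by labelled blocks\<close>

text \<open>The block \<open>c i\<close> has label i, and g is a semigroup operation on labels. The
  assumption \<open>compat\<close> says that the block of a value of F is found by folding g over
  the labels of its arguments. The label type is free: indices serve for Cayley tables, bits for
  parity.\<close>

locale labelled_quotient =
  fixes A :: "'a set" and L :: "'l set" and c :: "'l \<Rightarrow> 'a set" and g :: "'l \<Rightarrow> 'l \<Rightarrow> 'l"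
    and m :: nat and F :: "'a list \<Rightarrow> 'a"
  assumes nonempty: "\<forall>i\<in>L. c i \<noteq> {}"
    and disjoint: "\<forall>i\<in>L. \<forall>j\<in>L. i \<noteq> j \<longrightarrow> c i \<inter> c j = {}"
    and cover: "A = (\<Union>i\<in>L. c i)"
    and closed: "\<forall>i\<in>L. \<forall>j\<in>L. g i j \<in> L"
    and assoc: "\<forall>i\<in>L. \<forall>j\<in>L. \<forall>k\<in>L. g (g i j) k = g i (g j k)"
    and m_pos: "m > 0"
    and compat: "\<And>xs ls. ls \<in> tuples m L \<Longrightarrow> list_all2 (\<lambda>x i. x \<in> c i) xs ls \<Longrightarrow>
                   F xs \<in> c (foldl g (hd ls) (tl ls))"
begin

definition "\<theta> = (\<Union>i\<in>L. c i \<times> c i)"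

abbreviation "G ls \<equiv> foldl g (hd ls) (tl ls)"

lemma mem_unique: "x \<in> c i \<Longrightarrow> x \<in> c j \<Longrightarrow> i \<in> L \<Longrightarrow> j \<in> L \<Longrightarrow> i = j"
  using disjoint by blast

lemma inj_c: "inj_on c L"
  using nonempty mem_unique unfolding inj_on_def by (metis all_not_in_conv)

lemma equiv: "equiv A \<theta>"
proof (rule equivI)
  show "refl_on A \<theta>" unfolding refl_on_def \<theta>_def cover by auto
  show "sym \<theta>" unfolding sym_def \<theta>_def by auto
  show "trans \<theta>" unfolding trans_def \<theta>_def using mem_unique by blast
  show "\<theta> \<subseteq> A \<times> A" unfolding \<theta>_def cover by auto
qed

lemma class_eq: "i \<in> L \<Longrightarrow> x \<in> c i \<Longrightarrow> \<theta> `` {x} = c i"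
  using mem_unique by (auto simp: \<theta>_def)

lemma quotient_eq: "A // \<theta> = c ` L"
proof
  show "A // \<theta> \<subseteq> c ` L"
    by (auto simp: quotient_def cover class_eq)
  show "c ` L \<subseteq> A // \<theta>"
  proof (rule image_subsetI)
    fix i assume i: "i \<in> L"
    then obtain x where x: "x \<in> c i" using nonempty by blast
    then have "x \<in> A" using i cover by auto
    then show "c i \<in> A // \<theta>" using class_eq[OF i x] quotientI by metis
  qed
qed

lemma card_quotient: "card (A // \<theta>) = card L"
  by (simp add: quotient_eq card_image inj_c)

lemma G_closed: "ls \<in> tuples m L \<Longrightarrow> G ls \<in> L"
  using m_pos closed by (cases ls) (auto simp: tuples_def intro!: foldl_closed)

lemma quotient_op_eq:
  assumes "ls \<in> tuples m L"
  shows "quotient_op \<theta> F (map c ls) = c (G ls)"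
proof -
  have "\<theta> `` {F xs} = c (G ls)" if "xs \<in> listset (map c ls)" for xs
    using compat[OF assms, of xs] that G_closed[OF assms]
    by (intro class_eq) (auto simp: listset_eq list_all2_map2)
  \<comment> \<open>All choices of representatives give the same class; at least one choice must
    exist, as an empty union would not be that class.\<close>
  moreover have "map (\<lambda>i. SOME x. x \<in> c i) ls \<in> listset (map c ls)"
    using assms nonempty
    by (auto simp: listset_eq list_all2_map1 list_all2_map2 list_all2_same tuples_def some_in_eq)
  ultimately show ?thesis unfolding quotient_op_def by blast
qed

lemma tuples_quotient: "tuples m (A // \<theta>) = map c ` tuples m L"
proof
  show "tuples m (A // \<theta>) \<subseteq> map c ` tuples m L"
  proof
    fix Cs assume Cs: "Cs \<in> tuples m (A // \<theta>)"
    then have "map c (map (inv_into L c) Cs) = Cs"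
      unfolding map_map tuples_def quotient_eq
      by (intro map_idI) (auto simp: f_inv_into_f subset_iff)
    moreover have "map (inv_into L c) Cs \<in> tuples m L"
      using Cs by (auto simp: tuples_def quotient_eq subset_iff inv_into_into)
    ultimately show "Cs \<in> map c ` tuples m L" by (metis imageI)
  qed
qed (auto simp: tuples_def quotient_eq subset_iff)

text \<open>Related lists have the same list of labels, and \<open>compat\<close> puts both values
  of F into the one block that these labels determine.\<close>

lemma congruence: "mary_congruence m A F \<theta>"
proof -
  define lab where "lab x = (SOME i. i \<in> L \<and> x \<in> c i)" for x
  have lab: "lab x \<in> L \<and> x \<in> c (lab x)" if "x \<in> A" for x
    unfolding lab_def by (rule someI_ex) (use that cover in auto)
  have "(F xs, F ys) \<in> \<theta>"
    if xs: "xs \<in> tuples m A" and rel: "list_all2 (\<lambda>x y. (x, y) \<in> \<theta>) xs ys" for xs ys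
  proof -
    have t: "map lab xs \<in> tuples m L" using xs lab by (auto simp: tuples_def)
    have "list_all2 (\<lambda>x i. x \<in> c i) xs (map lab xs)"
      using xs lab by (auto simp: list_all2_map2 list_all2_same tuples_def)
    moreover have "list_all2 (\<lambda>x i. x \<in> c i) ys (map lab xs)"
    proof (rule list_all2_all_nthI)
      show len: "length ys = length (map lab xs)" using rel by (simp add: list_all2_lengthD)
      fix k assume k: "k < length ys"
      then have "xs ! k \<in> A" using xs len by (auto simp: tuples_def)
      moreover have "(xs ! k, ys ! k) \<in> \<theta>" using list_all2_nthD2[OF rel k] by simp
      ultimately have "ys ! k \<in> c (lab (xs ! k))"
        using lab class_eq by blast
      then show "ys ! k \<in> c (map lab xs ! k)" using k len by simp
    qed
    ultimately show ?thesis
      using compat[OF t] G_closed[OF t] unfolding \<theta>_def by blast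
  qed
  then show ?thesis by (simp add: mary_congruence_def equiv)
qed

lemma foldl_labelled_op:
  assumes "\<forall>i\<in>L. \<forall>j\<in>L. f i j \<in> L" "i \<in> L" "set ls \<subseteq> L"
  shows "foldl (\<lambda>x y. labelled_op L c f (x, y)) (c i) (map c ls) = c (foldl f i ls)"
  using assms(2,3)
  by (induction ls arbitrary: i) (use assms(1) in \<open>auto simp: labelled_op_apply[OF inj_c]\<close>)

text \<open>The labelling is a bijection from L to the quotient that turns the fold of g into the
  quotient operation, so being a reduction can be tested on labels.\<close>

lemma binary_reduction_labelled_op_iff:
  assumes "\<forall>i\<in>L. \<forall>j\<in>L. f i j \<in> L"
  shows "labelled_op L c f \<in> binary_reductions m (A // \<theta>) (quotient_op \<theta> F) \<longleftrightarrow>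
    reduces m L G f"
proof -
  have fold: "(quotient_op \<theta> F (map c ls) =
       foldl (\<lambda>x y. labelled_op L c f (x, y)) (hd (map c ls)) (tl (map c ls))) \<longleftrightarrow>
      G ls = foldl f (hd ls) (tl ls)" if ls: "ls \<in> tuples m L" for ls
  proof -
    obtain i js where ls_eq: "ls = i # js" using ls m_pos by (cases ls) (auto simp: tuples_def)
    then have i: "i \<in> L" "set js \<subseteq> L" using ls by (auto simp: tuples_def)
    have "foldl f i js \<in> L" using foldl_closed[OF assms i] .
    then show ?thesis
      using quotient_op_eq[OF ls] foldl_labelled_op[OF assms i] G_closed[OF ls] inj_c
      by (auto simp: ls_eq inj_on_eq_iff)
  qed
  have ext: "labelled_op L c f \<in> extensional ((A // \<theta>) \<times> (A // \<theta>))"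
    by (simp add: labelled_op_def quotient_eq)
  have "reduces m (A // \<theta>) (quotient_op \<theta> F) (\<lambda>x y. labelled_op L c f (x, y)) \<longleftrightarrow>
      reduces m L G f"
    unfolding reduces_def tuples_quotient ball_simps(9)
    using assms fold
    by (auto simp: quotient_eq labelled_op_apply[OF inj_c] inj_on_eq_iff[OF inj_c])
  then show ?thesis by (simp add: binary_reductions_iff ext)
qed

text \<open>An operation on the classes is extensional, hence it is determined by its pullback to
  labels. Operations f that agree on L give one and the same element of the image.\<close>

lemma binary_reductions_eq:
  "binary_reductions m (A // \<theta>) (quotient_op \<theta> F) = labelled_op L c ` {f. reduces m L G f}"
proof
  show "labelled_op L c ` {f. reduces m L G f} \<subseteq>
      binary_reductions m (A // \<theta>) (quotient_op \<theta> F)"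
    using binary_reduction_labelled_op_iff by (auto simp: reduces_def)
  show "binary_reductions m (A // \<theta>) (quotient_op \<theta> F) \<subseteq> labelled_op L c ` {f. reduces m L G f}"
  proof
    fix h assume h: "h \<in> binary_reductions m (A // \<theta>) (quotient_op \<theta> F)"
    define f where "f i j = inv_into L c (h (c i, c j))" for i j
    have h_closed: "h (c i, c j) \<in> c ` L" if "i \<in> L" "j \<in> L" for i j
      using h that by (auto simp: binary_reductions_iff reduces_def quotient_eq)
    then have f_closed: "\<forall>i\<in>L. \<forall>j\<in>L. f i j \<in> L"
      by (auto simp: f_def inv_into_into)
    have "h = labelled_op L c f"
    proof (rule extensionalityI[of _ "c ` L \<times> c ` L"])
      show "h \<in> extensional (c ` L \<times> c ` L)"
        using h by (simp add: binary_reductions_iff quotient_eq)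
      show "labelled_op L c f \<in> extensional (c ` L \<times> c ` L)"
        by (simp add: labelled_op_def)
    qed (auto simp: labelled_op_apply[OF inj_c] f_def f_inv_into_f[OF h_closed])
    then show "h \<in> labelled_op L c ` {f. reduces m L G f}"
      using h binary_reduction_labelled_op_iff[OF f_closed] by auto
  qed
qed

lemma reduces_g: "reduces m L G g"
  using closed assoc by (simp add: reduces_def)

lemma reducible: "binary_reducible m (A // \<theta>) (quotient_op \<theta> F)"
  using reduces_g by (auto simp: binary_reducible_def binary_reductions_eq)

lemma binary_reductions_unique:
  assumes "m \<ge> 3"
    and "\<forall>x\<in>L. \<exists>e\<in>L. G (replicate m e) = e \<and> (\<forall>a\<in>L. a \<noteq> e \<longrightarrow> G (e # replicate (m - 1) a) \<noteq> e) \<and>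
           G (replicate (m - 1) e @ [x]) = x"
  shows "binary_reductions m (A // \<theta>) (quotient_op \<theta> F) = {labelled_op L c g}"
proof -
  have "labelled_op L c f = labelled_op L c g" if f: "reduces m L G f" for f
  proof (rule labelled_op_cong)
    fix i j assume ij: "i \<in> L" "j \<in> L"
    then obtain e where "e \<in> L" "G (replicate m e) = e"
      "\<And>a. a \<in> L \<Longrightarrow> a \<noteq> e \<Longrightarrow> G (e # replicate (m - 1) a) \<noteq> e" "G (replicate (m - 1) e @ [i]) = i"
      using assms(2) by blast
    then show "f i j = g i j"
      using reduces_unique[OF f reduces_g assms(1) ij] by blast
  qed
  then show ?thesis unfolding binary_reductions_eq using reduces_g by blast
qed

text \<open>If every label equals its cube, then for odd m the power with exponent m - 1 is the
  square. The count then depends on the table only and not on m.\<close>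

lemma card_left_neutrals:
  assumes "odd m" "m \<ge> 3" and cube: "\<forall>i\<in>L. g (g i i) i = i"
  shows "card (left_neutrals m (A // \<theta>) (quotient_op \<theta> F)) =
    card {i \<in> L. \<forall>j\<in>L. g (g i i) j = j}"
proof -
  obtain k where "m = 2 * k + 1" using \<open>odd m\<close> by (rule oddE)
  then obtain n where m: "m = 2 * n + 3" using \<open>m \<ge> 3\<close> by (cases k) auto
  have fold: "foldl g i (replicate (2 * n) i) = i" if "i \<in> L" for i
    by (induction n) (use that cube in auto)
  \<comment> \<open>The first 2n + 1 factors fold to i by the cube law, which leaves the last factor
    i and j.\<close>
  have rep: "replicate (m - 1) i @ [j] = (i # replicate (2 * n) i) @ [i, j]" for i j :: 'l
    by (simp add: m replicate_app_Cons_same)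
  have "G (replicate (m - 1) i @ [j]) = g (g i i) j" if "i \<in> L" for i j
    unfolding rep using fold[OF that] by simp
  then have "left_neutrals m L G = {i \<in> L. \<forall>j\<in>L. g (g i i) j = j}"
    by (auto simp: left_neutrals_def)
  moreover have "card (left_neutrals m L G) =
      card (left_neutrals m (A // \<theta>) (quotient_op \<theta> F))"
    by (rule card_left_neutrals_eq[of c])
       (use G_closed m_pos in \<open>auto simp: bij_betw_def inj_c quotient_eq quotient_op_eq\<close>)
  ultimately show ?thesis by simp
qed

end

lemma labelled_quotients_isomorphic:
  assumes "labelled_quotient A L c g m F" "labelled_quotient A' L' c' g' m F'"
    and p: "bij_betw p L L'" "\<forall>i\<in>L. \<forall>j\<in>L. p (g i j) = g' (p i) (p j)"
  shows "mary_isomorphic m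
    (A // labelled_quotient.\<theta> L c) (quotient_op (labelled_quotient.\<theta> L c) F)
    (A' // labelled_quotient.\<theta> L' c') (quotient_op (labelled_quotient.\<theta> L' c') F')"
proof -
  interpret Q: labelled_quotient A L c g m F by fact
  interpret Q': labelled_quotient A' L' c' g' m F' by fact
  have fold: "p (foldl g i ls) = foldl g' (p i) (map p ls)" if "i \<in> L" "set ls \<subseteq> L" for i ls
    using that by (induction ls arbitrary: i) (use p Q.closed in auto)
  \<comment> \<open>The isomorphism reads off the label of a class, applies p, and takes the block
    with the resulting label.\<close>
  define h where "h = (\<lambda>C. c' (p (inv_into L c C)))"
  have hc: "h (c i) = c' (p i)" if "i \<in> L" for i
    using that Q.inj_c by (simp add: h_def)
  have c': "bij_betw c' L' (A' // Q'.\<theta>)" by (simp add: bij_betw_def Q'.inj_c Q'.quotient_eq)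
  have "bij_betw (inv_into L c) (A // Q.\<theta>) L"
    by (intro bij_betw_inv_into) (simp add: bij_betw_def Q.inj_c Q.quotient_eq)
  then have "bij_betw (c' \<circ> (p \<circ> inv_into L c)) (A // Q.\<theta>) (A' // Q'.\<theta>)"
    by (intro bij_betw_trans[OF _ c'] bij_betw_trans[OF _ p(1)])
  then have "bij_betw h (A // Q.\<theta>) (A' // Q'.\<theta>)" by (simp add: h_def comp_def)
  moreover have "h (quotient_op Q.\<theta> F (map c ls)) = quotient_op Q'.\<theta> F' (map h (map c ls))"
    if ls: "ls \<in> tuples m L" for ls
  proof -
    have pls: "map p ls \<in> tuples m L'" using ls p(1) by (auto simp: tuples_def bij_betw_def)
    have "map h (map c ls) = map c' (map p ls)" using ls hc by (auto simp: tuples_def)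
    then have "quotient_op Q'.\<theta> F' (map h (map c ls)) = c' (Q'.G (map p ls))"
      by (simp only: Q'.quotient_op_eq[OF pls])
    also have "Q'.G (map p ls) = p (Q.G ls)"
      using ls Q.m_pos by (cases ls) (auto simp: tuples_def fold)
    finally show ?thesis by (simp only: hc Q.G_closed[OF ls] Q.quotient_op_eq[OF ls])
  qed
  ultimately show ?thesis
    unfolding mary_isomorphic_def Q.tuples_quotient by blast
qed

section \<open>The operations H\<close>

lemma in_X_iff: "x \<in> X \<longleftrightarrow> x = 1 \<or> x = 2 \<or> x = 3 \<or> x = 4"
  by (simp add: X_def)

text \<open>Describing the constant lists by inclusions of sets makes both conditions split along
  concatenation; it also covers the empty list.\<close>

lemma H_eq:
  assumes "length xs = m"
  shows "H m xs = (if set xs \<subseteq> {1} then 1 else if set xs \<subseteq> {2} then 2 else eta (sum_list (map eps xs)))"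
proof -
  have "xs = replicate m a \<longleftrightarrow> set xs \<subseteq> {a}" for a :: nat
    using assms replicate_length_same[of xs a] set_replicate_conv_if[of m a]
    by (metis empty_subsetI singletonD subset_iff subset_refl)
  then show ?thesis by (simp add: H_def)
qed

lemma H_in_X: "H m xs \<in> X"
  by (auto simp: H_def eta_def X_def)

lemma eta_neq: "eta b \<noteq> 1" "eta b \<noteq> 2"
  by (auto simp: eta_def)

lemma eps_eta: "eps (eta b) = b"
  by (cases b) (auto simp: eps_def eta_def)

lemma sum_list_replicate_bit: "sum_list (replicate n (b::bit)) = (if odd n then b else 0)"
  by (induction n) auto

lemma H_eq_iff:
  assumes "length xs = m" "m > 0"
  shows "H m xs = 1 \<longleftrightarrow> set xs \<subseteq> {1}" "H m xs = 2 \<longleftrightarrow> set xs \<subseteq> {2}"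
  using assms eta_neq by (cases xs; auto simp: H_eq)+

text \<open>The exceptional values obey the parity rule as well: an odd number of ones has sum 0, an
  odd number of twos has sum 1. So \<open>eps\<close> is a homomorphism onto addition in
  \<open>bit\<close>.\<close>

lemma eps_H:
  assumes "length xs = m" "odd m"
  shows "eps (H m xs) = sum_list (map eps xs)"
  using assms by (auto simp: H_def eps_eta map_replicate sum_list_replicate_bit)

text \<open>By \<open>H_eq\<close>, only two things matter: whether all entries are 1 or all are 2,
  and the parity sum. Replacing the odd block \<open>vs\<close> by its value preserves the first by
  \<open>H_eq_iff\<close> and the second by \<open>eps_H\<close>.\<close>

lemma H_insert:
  assumes "odd k" "length vs = k" "m = length us + 1 + length ws" "n = length us + k + length ws"
  shows "H m (us @ H k vs # ws) = H n (us @ vs @ ws)"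
proof -
  have "vs \<noteq> []" using assms by auto
  have "set (us @ H k vs # ws) \<subseteq> {a} \<longleftrightarrow> set (us @ vs @ ws) \<subseteq> {a}" if "a = 1 \<or> a = 2" for a
    using H_eq_iff[OF assms(2)] that \<open>odd k\<close> by (auto simp: odd_pos)
  moreover have "sum_list (map eps (us @ H k vs # ws)) = sum_list (map eps (us @ vs @ ws))"
    using assms by (simp add: eps_H add.assoc)
  moreover have "length (us @ H k vs # ws) = m" "length (us @ vs @ ws) = n"
    using assms by simp_all
  ultimately show ?thesis
    by (simp only: H_eq simp_thms)
qed

text \<open>Whatever the position of the inner block, \<open>H_insert\<close> turns the bracketed
  product into the value of H on all 2m - 1 entries.\<close>

lemma mary_semigroup_H:
  assumes "odd m"
  shows "mary_semigroup m X (H m)"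
proof -
  have "H m (take i ws @ H m (take m (drop i ws)) # drop (i + m) ws) = H (2 * m - 1) ws"
    if "length ws = 2 * m - 1" "i < m" for ws i
  proof -
    have "H m (take i ws @ H m (take m (drop i ws)) # drop (i + m) ws) =
        H (2 * m - 1) (take i ws @ take m (drop i ws) @ drop (i + m) ws)"
      by (rule H_insert) (use assms that in auto)
    also have "take i ws @ take m (drop i ws) @ drop (i + m) ws = ws"
      by (metis append_take_drop_id drop_drop add.commute)
    finally show ?thesis .
  qed
  then show ?thesis by (simp add: mary_semigroup_def H_in_X tuples_def)
qed

lemma H_one: "x \<in> X \<Longrightarrow> H 1 [x] = x"
  by (auto simp: X_def H_def eps_def eta_def)

lemma H_three:
  "H 3 [x, y, z] = (if x = 1 \<and> y = 1 \<and> z = 1 then 1 else if x = 2 \<and> y = 2 \<and> z = 2 then 2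
     else eta (eps x + eps y + eps z))"
proof -
  have "sum_list (map eps [x, y, z]) = eps x + eps y + eps z"
    by (simp only: list.map sum_list.Cons sum_list.Nil add_0_right add.assoc)
  then show ?thesis
    by (auto simp: H_def numeral_3_eq_3 simp del: sum_list.Cons list.map)
qed

text \<open>Induction on n with m = 2n + 1: \<open>H_insert\<close> contracts the first three
  entries to their value under \<open>H 3\<close>, while their labels contract to
  \<open>g (g i j) k\<close>. The start n = 0 holds because \<open>H 1\<close> is the identity on
  X.\<close>

lemma H_compat:
  assumes closed: "\<forall>i\<in>L. \<forall>j\<in>L. g i j \<in> L" and cover: "(\<Union>i\<in>L. c i) = X"
    and three: "\<forall>i\<in>L. \<forall>j\<in>L. \<forall>k\<in>L. \<forall>x\<in>c i. \<forall>y\<in>c j. \<forall>z\<in>c k. H 3 [x, y, z] \<in> c (g (g i j) k)"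
    and "odd m" "ls \<in> tuples m L" "list_all2 (\<lambda>x i. x \<in> c i) xs ls"
  shows "H m xs \<in> c (foldl g (hd ls) (tl ls))"
  using \<open>odd m\<close>
proof (elim oddE)
  fix n assume "m = 2 * n + 1"
  with assms(5,6) have "length ls = 2 * n + 1" "set ls \<subseteq> L" "list_all2 (\<lambda>x i. x \<in> c i) xs ls"
    by (auto simp: tuples_def)
  then have "H (2 * n + 1) xs \<in> c (foldl g (hd ls) (tl ls))"
  proof (induction n arbitrary: ls xs)
    case 0
    then obtain i x where i: "ls = [i]" "xs = [x]" "x \<in> c i" "i \<in> L"
      by (auto simp: length_Suc_conv list_all2_Cons2)
    then have "x \<in> X" using cover by blast
    then show ?case using i H_one by simp
  next
    case (Suc n)
    then obtain i j k ls' where ls: "ls = i # j # k # ls'" "length ls' = 2 * n"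
      by (auto simp: length_Suc_conv)
    with Suc.prems obtain x y z xs' where xs: "xs = x # y # z # xs'"
        "x \<in> c i" "y \<in> c j" "z \<in> c k" "list_all2 (\<lambda>x i. x \<in> c i) xs' ls'"
      by (auto simp: list_all2_Cons2)
    have L: "i \<in> L" "j \<in> L" "k \<in> L" "set ls' \<subseteq> L" using Suc.prems ls by auto
    have "H (2 * n + 1) (H 3 [x, y, z] # xs') \<in>
        c (foldl g (hd (g (g i j) k # ls')) (tl (g (g i j) k # ls')))"
      by (rule Suc.IH) (use xs ls L closed three in auto)
    moreover have "H (2 * n + 1) ([] @ H 3 [x, y, z] # xs') = H (2 * Suc n + 1) ([] @ [x, y, z] @ xs')"
      by (rule H_insert) (use xs ls in \<open>auto dest: list_all2_lengthD\<close>)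
    ultimately show ?case using xs ls by simp
  qed
  then show ?thesis using \<open>m = 2 * n + 1\<close> by simp
qed

lemma labelled_quotient_H:
  assumes "odd m" "\<forall>i\<in>L. c i \<noteq> {}" "\<forall>i\<in>L. \<forall>j\<in>L. i \<noteq> j \<longrightarrow> c i \<inter> c j = {}" "(\<Union>i\<in>L. c i) = X"
    and "\<forall>i\<in>L. \<forall>j\<in>L. g i j \<in> L" "\<forall>i\<in>L. \<forall>j\<in>L. \<forall>k\<in>L. g (g i j) k = g i (g j k)"
    and "\<forall>i\<in>L. \<forall>j\<in>L. \<forall>k\<in>L. \<forall>x\<in>c i. \<forall>y\<in>c j. \<forall>z\<in>c k. H 3 [x, y, z] \<in> c (g (g i j) k)"
  shows "labelled_quotient X L c g m (H m)"
  by unfold_locales (use assms H_compat[of L g c m] in \<open>auto simp: odd_pos\<close>)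

section \<open>Irreducibility\<close>

lemma H_not_reducible:
  assumes "odd m" "m \<ge> 3"
  shows "\<not> binary_reducible m X (H m)"
proof
  assume "binary_reducible m X (H m)"
  then obtain f where f: "reduces m X (H m) f"
    by (auto simp: binary_reducible_def binary_reductions_iff)
  have "m > 0" using assms by simp
  have idem: "f e e = e" if "e = 1 \<or> e = 2" for e
  proof (rule reduces_idempotent[OF f \<open>m > 0\<close>])
    \<comment> \<open>The value 1 or 2 is attained only on the corresponding constant list.\<close>
    show "H m (e # replicate (m - 1) a) \<noteq> e" if "a \<noteq> e" for a
      using H_eq_iff[of "e # replicate (m - 1) a" m] \<open>e = 1 \<or> e = 2\<close> that assms by auto
  qed (use that \<open>m > 0\<close> in \<open>auto simp: X_def H_def\<close>)
  have "f 1 2 = H m (replicate (m - 1) 1 @ [2])"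
    by (rule reduces_idempotent_prefix(1)[symmetric, OF f \<open>m \<ge> 3\<close>]) (auto simp: X_def idem)
  also have "\<dots> = 3"
    using assms by (auto simp: H_eq eps_def eta_def map_replicate sum_list_replicate_bit)
  finally have "f 1 2 = 3" .
  \<comment> \<open>Associativity together with idempotence of 2. The prefix lemma evaluates the two
    sides to 3 and 4, since appending a second 2 changes the parity.\<close>
  moreover have "f 1 2 = f (f 1 2) 2"
    using f idem[of 2] by (auto simp: reduces_def X_def)
  moreover have "f (f 1 2) 2 = H m (replicate (m - 2) 1 @ [2, 2])"
    by (rule reduces_idempotent_prefix(2)[symmetric, OF f \<open>m \<ge> 3\<close>]) (auto simp: X_def idem)
  moreover have "\<dots> = 4"
    using assms by (auto simp: H_eq eps_def eta_def map_replicate sum_list_replicate_bit)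
  ultimately show False by simp
qed

section \<open>Constraints on congruences\<close>

lemma congruence_replicate:
  assumes "mary_congruence m X (H m) \<theta>" "(a, b) \<in> \<theta>" "e \<in> X" "k \<le> m"
  shows "(H m (replicate (m - k) e @ replicate k a), H m (replicate (m - k) e @ replicate k b)) \<in> \<theta>"
proof -
  have eq: "equiv X \<theta>" using assms(1) by (simp add: mary_congruence_def)
  then have ab: "a \<in> X" "b \<in> X" and "(e, e) \<in> \<theta>"
    using assms(2,3) by (auto simp: equiv_def refl_on_def)
  then have "list_all2 (\<lambda>x y. (x, y) \<in> \<theta>)
      (replicate (m - k) e @ replicate k a) (replicate (m - k) e @ replicate k b)"
    using assms(2) by (intro list_all2_appendI) (auto simp: list_all2_conv_all_nth)
  moreover have "replicate (m - k) e @ replicate k x \<in> tuples m X" if "x \<in> X" for x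
    using assms(3,4) that by (auto simp: tuples_def)
  ultimately show ?thesis using assms(1) ab unfolding mary_congruence_def by blast
qed

text \<open>The last one or two entries of a list of copies of e, where e is 1 or 2, are changed
  inside a class. One of the two lists compared is constant and keeps its value e, while the other
  takes a value 3 or 4 fixed by parity.\<close>

lemma congruence_closure:
  assumes "odd m" "m \<ge> 3" and \<theta>: "mary_congruence m X (H m) \<theta>"
  shows "(1, 2) \<in> \<theta> \<Longrightarrow> (1, 3) \<in> \<theta>" "(1, 2) \<in> \<theta> \<Longrightarrow> (4, 2) \<in> \<theta>"
    and "(1, 3) \<in> \<theta> \<Longrightarrow> (1, 4) \<in> \<theta>" "(2, 4) \<in> \<theta> \<Longrightarrow> (2, 3) \<in> \<theta>"
proof -
  \<comment> \<open>The value of \<open>H m\<close> on m - k copies of e followed by k copies of a,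
    for k = 1 or k = 2.\<close>
  define val where "val k e a = (if e = a \<and> (a = 1 \<or> a = 2) then a
      else eta ((if odd (m - k) then eps e else 0) + (if odd k then eps a else 0)))" for k e a
  have "H m (replicate (m - k) e @ replicate k a) = val k e a" if "k = 1 \<or> k = 2" for k e a
    using that assms(1,2) unfolding val_def
    by (auto simp: H_eq map_replicate sum_list_replicate_bit set_replicate_conv_if eps_def)
  then have val: "(val k e a, val k e b) \<in> \<theta>"
    if "(a, b) \<in> \<theta>" "e \<in> X" "k = 1 \<or> k = 2" for k e a b
    using congruence_replicate[OF \<theta> that(1,2), of k] that(3) assms(2) by auto
  note [simp] = val_def eps_def eta_def X_def
  \<comment> \<open>In these four instances the first number is e and the second is k.\<close>
  show "(1, 3) \<in> \<theta>" if "(1, 2) \<in> \<theta>" using val[OF that, of 1 1] assms(1,2) by simp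
  show "(4, 2) \<in> \<theta>" if "(1, 2) \<in> \<theta>" using val[OF that, of 2 1] assms(1,2) by simp
  show "(1, 4) \<in> \<theta>" if "(1, 3) \<in> \<theta>" using val[OF that, of 1 2] assms(1,2) by simp
  show "(2, 3) \<in> \<theta>" if "(2, 4) \<in> \<theta>" using val[OF that, of 2 2] assms(1,2) by simp
qed

text \<open>Reflexivity and symmetry reduce the comparison to the six pairs with x < y.\<close>

lemma equiv_X_eqI:
  assumes "equiv X \<theta>" "equiv X \<phi>"
    and "\<forall>(x, y)\<in>{(1, 2), (1, 3), (1, 4), (2, 3), (2, 4), (3, 4)}. (x, y) \<in> \<theta> \<longleftrightarrow> (x, y) \<in> \<phi>"
  shows "\<theta> = \<phi>"
proof -
  have sub: "\<theta> \<subseteq> X \<times> X" "\<phi> \<subseteq> X \<times> X"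
    using assms(1,2) by (auto simp: equiv_def refl_on_def)
  have refl: "(x, x) \<in> \<theta>" "(x, x) \<in> \<phi>" if "x \<in> X" for x
    using assms(1,2) that by (auto simp: equiv_def refl_on_def)
  have sym: "(x, y) \<in> \<theta> \<longleftrightarrow> (y, x) \<in> \<theta>" "(x, y) \<in> \<phi> \<longleftrightarrow> (y, x) \<in> \<phi>" for x y
    using assms(1,2) by (auto simp: equiv_def sym_def)
  have "(x, y) \<in> \<theta> \<longleftrightarrow> (x, y) \<in> \<phi>" if "x \<in> X" "y \<in> X" "x \<le> y" for x y
  proof -
    have "x = y \<or> (x, y) \<in> {(1, 2), (1, 3), (1, 4), (2, 3), (2, 4), (3, 4)}"
      using that by (auto simp: in_X_iff)
    then show ?thesis using assms(3) refl \<open>x \<in> X\<close> by blast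
  qed
  then have "(x, y) \<in> \<theta> \<longleftrightarrow> (x, y) \<in> \<phi>" if "x \<in> X" "y \<in> X" for x y
    using that sym[of x y] by (metis linear)
  then show ?thesis using sub by auto
qed

section \<open>The seven proper quotients\<close>

abbreviation "cayley_quotient m cs T \<equiv>
  labelled_quotient X {..<length cs} ((!) cs) (\<lambda>i j. T ! i ! j) m (H m)"

lemmas cong_defs =
  cong_nabla_def cong_alpha_def cong_pi_def cong_beta_def cong_lambda_def cong_mu_def cong_nu_def
lemmas class_defs = nabla_classes_def alpha_classes_def pi_classes_def beta_classes_def
  lambda_classes_def mu_classes_def nu_classes_def

text \<open>By \<open>labelled_quotient_H\<close> only associativity of the tables and agreement
  with \<open>H 3\<close> on triples remain, a finite evaluation that serves all odd m at
  once.\<close>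

lemma cayley_quotients:
  assumes "odd m"
  shows "cayley_quotient m nabla_classes [[0]]"
    and "cayley_quotient m alpha_classes [[0, 0], [0, 1]]"
    and "cayley_quotient m beta_classes [[0, 1], [1, 1]]"
    and "cayley_quotient m lambda_classes [[0, 1, 2], [1, 2, 1], [2, 1, 2]]"
    and "cayley_quotient m mu_classes [[2, 0, 0], [0, 1, 2], [0, 2, 2]]"
    and "cayley_quotient m nu_classes [[0, 2, 2], [2, 1, 2], [2, 2, 2]]"
  by (rule labelled_quotient_H[OF assms];
      simp add: class_defs lessThan_Suc numeral_2_eq_2 X_def H_three eps_def eta_def insert_commute)+

lemma UNIV_bit: "(UNIV :: bit set) = {0, 1}"
  by (auto intro: bit.exhaust)

lemma parity_quotient:
  assumes "odd m"
  shows "labelled_quotient X UNIV parity_class (+) m (H m)"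
proof (rule labelled_quotient_H[OF assms])
  show "(\<Union>i\<in>UNIV. parity_class i) = X"
    by (auto simp: UNIV_bit parity_class_def X_def)
  show "\<forall>i\<in>UNIV. \<forall>j\<in>UNIV. \<forall>k\<in>UNIV. \<forall>x\<in>parity_class i. \<forall>y\<in>parity_class j. \<forall>z\<in>parity_class k.
      H 3 [x, y, z] \<in> parity_class (i + j + k)"
    unfolding UNIV_bit by (simp add: parity_class_def H_three eps_def eta_def)
qed (auto simp: parity_class_def add.assoc)

lemma cayley_congruence:
  "labelled_quotient.\<theta> {..<length cs} ((!) cs) = equiv_of_classes cs"
  if "cayley_quotient m cs T"
  unfolding labelled_quotient.\<theta>_def[OF that] equiv_of_classes_def
  by (auto simp: set_conv_nth)

lemma parity_congruence: "labelled_quotient.\<theta> UNIV parity_class = cong_pi"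
  \<comment> \<open>The relation depends on the labels and blocks only, so the instance m = 1
    suffices.\<close>
  unfolding labelled_quotient.\<theta>_def[OF parity_quotient[OF odd_one]]
  by (simp add: UNIV_bit cong_pi_def equiv_of_classes_def pi_classes_def parity_class_def)

text \<open>The conditions of \<open>binary_reductions_unique\<close> with the head of each list
  split off, a form that can be evaluated for a numeral m.\<close>

lemma cayley_reductions:
  assumes Q: "cayley_quotient m cs T" and "m \<ge> 3"
    and "\<forall>x<length cs. \<exists>e<length cs.
      foldl (\<lambda>i j. T ! i ! j) e (replicate (m - 1) e) = e \<and>
      (\<forall>a<length cs. a \<noteq> e \<longrightarrow> foldl (\<lambda>i j. T ! i ! j) e (replicate (m - 1) a) \<noteq> e) \<and>
      foldl (\<lambda>i j. T ! i ! j) e (replicate (m - 2) e @ [x]) = x"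
  shows "H_quotient_reductions m (equiv_of_classes cs) = {cayley_op cs T}"
proof -
  obtain n where m: "m = Suc (Suc n)" using \<open>m \<ge> 3\<close> that[of "m - 2"] by simp
  show ?thesis
    using labelled_quotient.binary_reductions_unique[OF Q \<open>m \<ge> 3\<close>] assms(3)
    unfolding cayley_congruence[OF Q] H_quotient_reductions_def cayley_op_def
    by (simp add: m Ball_def Bex_def)
qed

lemma cayley_invariants:
  assumes Q: "cayley_quotient m cs T" and "odd m" "m \<ge> 3"
    and "\<forall>i<length cs. T ! (T ! i ! i) ! i = i"
  shows "card (X // equiv_of_classes cs) = length cs"
    and "card (left_neutrals m (X // equiv_of_classes cs) (quotient_op (equiv_of_classes cs) (H m))) =
      card {i. i < length cs \<and> (\<forall>j<length cs. T ! (T ! i ! i) ! j = j)}"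
  using labelled_quotient.card_quotient[OF Q] labelled_quotient.card_left_neutrals[OF Q assms(2,3)]
    assms(4)
  unfolding cayley_congruence[OF Q] by (simp_all add: Ball_def)

lemma cayley_isomorphic:
  assumes "cayley_quotient m cs T" "cayley_quotient m cs' T'"
    and "bij_betw p {..<length cs} {..<length cs'}"
    and "\<forall>i<length cs. \<forall>j<length cs. p (T ! i ! j) = T' ! p i ! p j"
  shows "H_quotients_isomorphic m (equiv_of_classes cs) (equiv_of_classes cs')"
  using labelled_quotients_isomorphic[OF assms(1,2,3)] assms(4)
  unfolding cayley_congruence[OF assms(1)] cayley_congruence[OF assms(2)] H_quotients_isomorphic_def
  by simp

lemma cayley_congruence_reducible:
  assumes "cayley_quotient m cs T"
  shows "mary_congruence m X (H m) (equiv_of_classes cs)"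
    and "binary_reducible m (X // equiv_of_classes cs) (quotient_op (equiv_of_classes cs) (H m))"
  using labelled_quotient.congruence[OF assms] labelled_quotient.reducible[OF assms]
  unfolding cayley_congruence[OF assms] by simp_all

lemma listed_congruences_reducible:
  assumes "odd m" "\<theta> \<in> listed_congruences"
  shows "mary_congruence m X (H m) \<theta>" "binary_reducible m (X // \<theta>) (quotient_op \<theta> (H m))"
  using assms(2) cayley_quotients[OF assms(1), THEN cayley_congruence_reducible(1)]
    cayley_quotients[OF assms(1), THEN cayley_congruence_reducible(2)]
    labelled_quotient.congruence[OF parity_quotient[OF assms(1)]]
    labelled_quotient.reducible[OF parity_quotient[OF assms(1)]]
  unfolding listed_congruences_def parity_congruence cong_nabla_def cong_alpha_def cong_beta_def
    cong_lambda_def cong_mu_def cong_nu_def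
  by auto

text \<open>The six pairs of \<open>equiv_X_eqI\<close> for each relation; they serve both to tell
  the relations apart and to recognize them.\<close>

lemma mem_listed:
  "(1, 2) \<in> cong_nabla" "(1, 3) \<in> cong_nabla" "(1, 4) \<in> cong_nabla"
  "(2, 3) \<in> cong_nabla" "(2, 4) \<in> cong_nabla" "(3, 4) \<in> cong_nabla"
  "(1, 2) \<notin> cong_alpha" "(1, 3) \<in> cong_alpha" "(1, 4) \<in> cong_alpha"
  "(2, 3) \<notin> cong_alpha" "(2, 4) \<notin> cong_alpha" "(3, 4) \<in> cong_alpha"
  "(1, 2) \<notin> cong_beta" "(1, 3) \<notin> cong_beta" "(1, 4) \<notin> cong_beta"
  "(2, 3) \<in> cong_beta" "(2, 4) \<in> cong_beta" "(3, 4) \<in> cong_beta"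
  "(1, 2) \<notin> cong_pi" "(1, 3) \<notin> cong_pi" "(1, 4) \<in> cong_pi"
  "(2, 3) \<in> cong_pi" "(2, 4) \<notin> cong_pi" "(3, 4) \<notin> cong_pi"
  "(1, 2) \<notin> cong_lambda" "(1, 3) \<notin> cong_lambda" "(1, 4) \<notin> cong_lambda"
  "(2, 3) \<in> cong_lambda" "(2, 4) \<notin> cong_lambda" "(3, 4) \<notin> cong_lambda"
  "(1, 2) \<notin> cong_mu" "(1, 3) \<notin> cong_mu" "(1, 4) \<in> cong_mu"
  "(2, 3) \<notin> cong_mu" "(2, 4) \<notin> cong_mu" "(3, 4) \<notin> cong_mu"
  "(1, 2) \<notin> cong_nu" "(1, 3) \<notin> cong_nu" "(1, 4) \<notin> cong_nu"
  "(2, 3) \<notin> cong_nu" "(2, 4) \<notin> cong_nu" "(3, 4) \<in> cong_nu"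
  by (simp_all add: cong_defs class_defs equiv_of_classes_def)

lemma listed_distinct:
  "distinct [cong_nabla, cong_alpha, cong_pi, cong_beta, cong_lambda, cong_mu, cong_nu]"
  using mem_listed by (auto simp del: One_nat_def)

text \<open>A case split on the pairs (1, 2), (1, 3) and (2, 4), each of which forces further pairs
  by \<open>congruence_closure\<close>. If all three are absent, few combinations of (1, 4), (2, 3)
  and (3, 4) are left.\<close>

lemma congruences_H:
  assumes "odd m" "m \<ge> 3"
  shows "{\<theta>. mary_congruence m X (H m) \<theta> \<and> \<theta> \<noteq> Id_on X} = listed_congruences"
proof (intro equalityI subsetI CollectI)
  fix \<theta> assume \<theta>: "\<theta> \<in> listed_congruences"
  then have "(1, 4) \<in> \<theta> \<or> (2, 3) \<in> \<theta> \<or> (3, 4) \<in> \<theta>"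
    unfolding listed_congruences_def using mem_listed by blast
  then have "\<theta> \<noteq> Id_on X" by auto
  then show "mary_congruence m X (H m) \<theta> \<and> \<theta> \<noteq> Id_on X"
    using listed_congruences_reducible(1)[OF assms(1) \<theta>] by simp
next
  fix \<theta> assume "\<theta> \<in> {\<theta>. mary_congruence m X (H m) \<theta> \<and> \<theta> \<noteq> Id_on X}"
  then have \<theta>: "mary_congruence m X (H m) \<theta>" and "\<theta> \<noteq> Id_on X" by auto
  then have eq: "equiv X \<theta>" by (simp add: mary_congruence_def)
  have listed: "\<theta> \<in> listed_congruences"
    if "\<phi> \<in> listed_congruences"
      "\<forall>(x, y)\<in>{(1, 2), (1, 3), (1, 4), (2, 3), (2, 4), (3, 4)}. (x, y) \<in> \<theta> \<longleftrightarrow> (x, y) \<in> \<phi>" for \<phi>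
  proof -
    have "equiv X \<phi>"
      using listed_congruences_reducible(1)[OF assms(1) that(1)] by (simp add: mary_congruence_def)
    then show ?thesis using equiv_X_eqI[OF eq _ that(2)] that(1) by simp
  qed
  have not_Id: "\<not> (\<forall>(x, y)\<in>{(1, 2), (1, 3), (1, 4), (2, 3), (2, 4), (3, 4)}. (x, y) \<notin> \<theta>)"
  proof
    assume "\<forall>(x, y)\<in>{(1, 2), (1, 3), (1, 4), (2, 3), (2, 4), (3, 4)}. (x, y) \<notin> \<theta>"
    moreover have "equiv X (Id_on X)"
      by (auto simp: equiv_def refl_on_def sym_def trans_def)
    ultimately have "\<theta> = Id_on X" by (intro equiv_X_eqI[OF eq]) auto
    then show False using \<open>\<theta> \<noteq> Id_on X\<close> by simp
  qed
  have sym: "(y, x) \<in> \<theta>" if "(x, y) \<in> \<theta>" for x y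
    using eq that by (auto simp: equiv_def sym_def)
  have trans: "(x, z) \<in> \<theta>" if "(x, y) \<in> \<theta>" "(y, z) \<in> \<theta>" for x y z
    using eq that by (auto simp: equiv_def trans_def)
  note closure = congruence_closure[OF assms \<theta>]
  consider "(1, 2) \<in> \<theta>" | "(1, 2) \<notin> \<theta>" "(1, 3) \<in> \<theta>" | "(1, 2) \<notin> \<theta>" "(1, 3) \<notin> \<theta>" "(2, 4) \<in> \<theta>"
    | "(1, 2) \<notin> \<theta>" "(1, 3) \<notin> \<theta>" "(2, 4) \<notin> \<theta>" by blast
  then show "\<theta> \<in> listed_congruences"
  proof cases
    case 1
    then have "(1, 3) \<in> \<theta>" "(2, 4) \<in> \<theta>" "(1, 4) \<in> \<theta>" "(2, 3) \<in> \<theta>" "(3, 4) \<in> \<theta>"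
      using closure sym trans by blast+
    with 1 show ?thesis
      by (intro listed[of cong_nabla]) (simp_all add: listed_congruences_def mem_listed del: One_nat_def)
  next
    case 2
    \<comment> \<open>A pair (2, 3) or (2, 4) would link 2 to 1, which this case excludes.\<close>
    then have "(1, 4) \<in> \<theta>" "(3, 4) \<in> \<theta>" "(2, 3) \<notin> \<theta>" "(2, 4) \<notin> \<theta>"
      using closure sym trans by blast+
    with 2 show ?thesis
      by (intro listed[of cong_alpha]) (simp_all add: listed_congruences_def mem_listed del: One_nat_def)
  next
    case 3
    then have "(2, 3) \<in> \<theta>" "(3, 4) \<in> \<theta>" "(1, 4) \<notin> \<theta>"
      using closure sym trans by blast+
    with 3 show ?thesis
      by (intro listed[of cong_beta]) (simp_all add: listed_congruences_def mem_listed del: One_nat_def)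
  next
    case 4
    note base = this
    \<comment> \<open>Either conjunction would give (1, 3) or (2, 4) by transitivity. Hence (3, 4)
      excludes the other two pairs.\<close>
    from 4 have "\<not> ((1, 4) \<in> \<theta> \<and> (3, 4) \<in> \<theta>)" "\<not> ((2, 3) \<in> \<theta> \<and> (3, 4) \<in> \<theta>)"
      using sym trans by blast+
    with 4 not_Id consider
        "(1, 4) \<in> \<theta>" "(2, 3) \<in> \<theta>" "(3, 4) \<notin> \<theta>"
      | "(1, 4) \<in> \<theta>" "(2, 3) \<notin> \<theta>" "(3, 4) \<notin> \<theta>"
      | "(1, 4) \<notin> \<theta>" "(2, 3) \<in> \<theta>" "(3, 4) \<notin> \<theta>"
      | "(1, 4) \<notin> \<theta>" "(2, 3) \<notin> \<theta>" "(3, 4) \<in> \<theta>"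
      by blast
    then show ?thesis
    proof cases
      case 1
      with base show ?thesis
        by (intro listed[of cong_pi]) (simp_all add: listed_congruences_def mem_listed del: One_nat_def)
    next
      case 2
      with base show ?thesis
        by (intro listed[of cong_mu]) (simp_all add: listed_congruences_def mem_listed del: One_nat_def)
    next
      case 3
      with base show ?thesis
        by (intro listed[of cong_lambda]) (simp_all add: listed_congruences_def mem_listed del: One_nat_def)
    next
      case 4
      with base show ?thesis
        by (intro listed[of cong_nu]) (simp_all add: listed_congruences_def mem_listed del: One_nat_def)
    qed
  qed
qed

section \<open>Isomorphism types of the quotients\<close>

definition quotient_invariants :: "nat \<Rightarrow> (nat \<times> nat) set \<Rightarrow> nat \<times> nat" where
  "quotient_invariants m \<theta> =
     (card (X // \<theta>), card (left_neutrals m (X // \<theta>) (quotient_op \<theta> (H m))))"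

lemma quotient_invariants_cayley:
  assumes "cayley_quotient m cs T" "odd m" "m \<ge> 3" "\<forall>i<length cs. T ! (T ! i ! i) ! i = i"
  shows "quotient_invariants m (equiv_of_classes cs) =
    (length cs, length (filter (\<lambda>i. \<forall>j<length cs. T ! (T ! i ! i) ! j = j) [0..<length cs]))"
proof -
  have "{i. i < length cs \<and> (\<forall>j<length cs. T ! (T ! i ! i) ! j = j)} =
      set (filter (\<lambda>i. \<forall>j<length cs. T ! (T ! i ! i) ! j = j) [0..<length cs])"
    by auto
  then show ?thesis
    unfolding quotient_invariants_def cayley_invariants[OF assms]
    by (simp add: distinct_card del: set_filter)
qed

lemma quotient_invariants_listed:
  assumes "odd m" "m \<ge> 3"
  shows "quotient_invariants m cong_nabla = (1, 1)"
    and "quotient_invariants m cong_alpha = (2, 1)" "quotient_invariants m cong_beta = (2, 1)"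
    and "quotient_invariants m cong_pi = (2, 2)"
    and "quotient_invariants m cong_lambda = (3, 1)" "quotient_invariants m cong_mu = (3, 1)"
    and "quotient_invariants m cong_nu = (3, 0)"
proof -
  note cayley = cayley_quotients[OF assms(1), THEN quotient_invariants_cayley, OF assms]
  note [simp] = class_defs less_Suc_eq numeral_3_eq_3 numeral_2_eq_2
  show "quotient_invariants m cong_nabla = (1, 1)"
    unfolding cong_nabla_def by (subst cayley(1)) auto
  show "quotient_invariants m cong_alpha = (2, 1)"
    unfolding cong_alpha_def by (subst cayley(2)) auto
  show "quotient_invariants m cong_beta = (2, 1)"
    unfolding cong_beta_def by (subst cayley(3)) auto
  show "quotient_invariants m cong_lambda = (3, 1)"
    unfolding cong_lambda_def by (subst cayley(4)) auto
  show "quotient_invariants m cong_mu = (3, 1)"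
    unfolding cong_mu_def by (subst cayley(5)) auto
  show "quotient_invariants m cong_nu = (3, 0)"
    unfolding cong_nu_def by (subst cayley(6)) auto
  note parity = parity_quotient[OF assms(1)]
  have card_bit: "card (UNIV :: bit set) = 2" by (simp add: UNIV_bit)
  \<comment> \<open>Both labels count, since i + i = 0 for each bit i.\<close>
  show "quotient_invariants m cong_pi = (2, 2)"
    using labelled_quotient.card_quotient[OF parity]
      labelled_quotient.card_left_neutrals[OF parity assms]
    unfolding parity_congruence quotient_invariants_def by (simp add: card_bit)
qed

lemma isomorphic_invariants:
  assumes "odd m" "\<theta> \<in> listed_congruences" "H_quotients_isomorphic m \<theta> \<phi>"
  shows "quotient_invariants m \<theta> = quotient_invariants m \<phi>"
  using mary_isomorphic_card_eq[OF assms(3)[unfolded H_quotients_isomorphic_def]]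
    binary_reducible_closed[OF listed_congruences_reducible(2)[OF assms(1,2)]] odd_pos[OF assms(1)]
  by (auto simp: quotient_invariants_def)

lemma isomorphic_listed:
  assumes "odd m"
  shows "H_quotients_isomorphic m cong_alpha cong_beta" "H_quotients_isomorphic m cong_beta cong_alpha"
    and "H_quotients_isomorphic m cong_lambda cong_mu" "H_quotients_isomorphic m cong_mu cong_lambda"
proof -
  note cayley = cayley_quotients[OF assms]
  \<comment> \<open>On X this relabelling comes from exchanging 1 with 2 and 3 with 4, an
    automorphism of \<open>H m\<close> for odd m.\<close>
  define p where "p i = (if i = 0 then 1 else if i = 1 then 0 else i)" for i :: nat
  have p: "bij_betw p {..<n} {..<n}" if "n \<ge> 2" for n
    by (rule bij_betw_byWitness[of _ p]) (use that in \<open>auto simp: p_def\<close>)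
  note [simp] = class_defs less_Suc_eq numeral_3_eq_3 numeral_2_eq_2
  show "H_quotients_isomorphic m cong_alpha cong_beta"
    unfolding cong_alpha_def cong_beta_def
    by (rule cayley_isomorphic[OF cayley(2,3), of p]) (use p in \<open>auto simp: p_def\<close>)
  show "H_quotients_isomorphic m cong_beta cong_alpha"
    unfolding cong_alpha_def cong_beta_def
    by (rule cayley_isomorphic[OF cayley(3,2), of p]) (use p in \<open>auto simp: p_def\<close>)
  show "H_quotients_isomorphic m cong_lambda cong_mu"
    unfolding cong_lambda_def cong_mu_def
    by (rule cayley_isomorphic[OF cayley(4,5), of p]) (use p in \<open>auto simp: p_def\<close>)
  show "H_quotients_isomorphic m cong_mu cong_lambda"
    unfolding cong_lambda_def cong_mu_def
    by (rule cayley_isomorphic[OF cayley(5,4), of p]) (use p in \<open>auto simp: p_def\<close>)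
qed

text \<open>The invariants coincide only within the pairs \<alpha>, \<beta> and \<lambda>, \<mu>,
  for which isomorphisms are known. The isomorphism classes are therefore the fibres of
  \<open>quotient_invariants\<close>.\<close>

lemma isomorphism_types:
  assumes "odd m" "m \<ge> 3"
  shows "listed_congruences // {(\<theta>, \<phi>). H_quotients_isomorphic m \<theta> \<phi> \<and>
      \<theta> \<in> listed_congruences \<and> \<phi> \<in> listed_congruences} =
    {{cong_nabla}, {cong_alpha, cong_beta}, {cong_pi}, {cong_lambda, cong_mu}, {cong_nu}}"
    (is "_ // ?R = _")
proof -
  have refl: "H_quotients_isomorphic m \<theta> \<theta>" for \<theta>
    by (simp add: H_quotients_isomorphic_def mary_isomorphic_refl)
  note inv = quotient_invariants_listed[OF assms]
  have "H_quotients_isomorphic m \<theta> \<phi>"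
    if "\<theta> \<in> listed_congruences" "\<phi> \<in> listed_congruences"
      "quotient_invariants m \<theta> = quotient_invariants m \<phi>" for \<theta> \<phi>
    using that unfolding listed_congruences_def
    by (elim insertE emptyE) (simp_all add: inv refl isomorphic_listed[OF assms(1)])
  then have iso_iff: "H_quotients_isomorphic m \<theta> \<phi> \<longleftrightarrow>
      quotient_invariants m \<phi> = quotient_invariants m \<theta>"
    if "\<theta> \<in> listed_congruences" "\<phi> \<in> listed_congruences" for \<theta> \<phi>
    using that isomorphic_invariants[OF assms(1)] by metis
  have R: "?R `` {\<theta>} =
      {\<phi> \<in> listed_congruences. quotient_invariants m \<phi> = quotient_invariants m \<theta>}"
    if "\<theta> \<in> listed_congruences" for \<theta>
    using that by (auto simp: iso_iff)
  \<comment> \<open>Evaluates a fibre by testing the seven relations one at a time.\<close>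
  have filter_insert: "{x \<in> insert a A. P x} = (if P a then insert a {x \<in> A. P x} else {x \<in> A. P x})"
    for a :: 'a and A P by auto
  have "listed_congruences // ?R =
      (\<lambda>\<theta>. {\<phi> \<in> listed_congruences. quotient_invariants m \<phi> = quotient_invariants m \<theta>})
        ` listed_congruences"
    unfolding quotient_def using R by auto
  also have "\<dots> = {{cong_nabla}, {cong_alpha, cong_beta}, {cong_pi}, {cong_lambda, cong_mu}, {cong_nu}}"
    unfolding listed_congruences_def image_insert filter_insert
    by (simp add: inv insert_commute)
  finally show ?thesis .
qed

text \<open>If neither element is idempotent, then \<open>0 1 = 0 (0 0) = (0 0) 0 = 1 0\<close>, and
  \<open>(0 1) 1 = 0 (1 1) = 0 0 = 1\<close> forces \<open>0 1 = 0\<close>, contradicting \<open>(0 1) 1 = 1\<close>.\<close>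

lemma bit_semigroup_idempotent:
  fixes f :: "bit \<Rightarrow> bit \<Rightarrow> bit"
  assumes "\<And>x y z. f (f x y) z = f x (f y z)"
  shows "\<exists>e. f e e = e"
proof -
  have "f 0 0 = 0 \<or> f 1 1 = 1"
  proof (rule ccontr)
    assume "\<not> ?thesis"
    then have sq: "f 0 0 = 1" "f 1 1 = 0" by simp_all
    then have "f (f 0 1) 1 = 1" using assms[of 0 1 1] by simp
    then show False using sq by (cases "f 0 1") auto
  qed
  then show ?thesis by blast
qed

text \<open>A reduction f has an idempotent e. Since m - 1 is even and m - 2 is odd, sums with m - 1
  or m - 2 copies of e give \<open>f e x = x\<close> and \<open>f x y = e + x + y\<close>; the two
  values of e are the two reductions.\<close>

lemma parity_reductions:
  assumes "odd m" "m \<ge> 3"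
  shows "H_quotient_reductions m cong_pi = {parity_op (\<lambda>x y. x + y), parity_op (\<lambda>x y. x + y + 1)}"
proof -
  interpret labelled_quotient X UNIV parity_class "(+)" m "H m"
    by (rule parity_quotient[OF assms(1)])
  note [simp del] = add_bit_eq_xor
  have foldl_add: "foldl (+) b bs = b + sum_list bs" for b :: bit and bs
    by (induction bs arbitrary: b) (simp_all only: foldl_Nil foldl_Cons sum_list.Nil sum_list.Cons add_0_right add.assoc)
  have G: "G bs = sum_list bs" if "bs \<noteq> []" for bs :: "bit list"
    using that by (cases bs) (simp_all add: foldl_add)
  have foldl_shift: "foldl (\<lambda>x y. x + y + 1) b bs = b + sum_list bs + of_nat (length bs)"
    for b :: bit and bs
    by (induction bs arbitrary: b) (simp_all only: foldl_Nil foldl_Cons sum_list.Nil sum_list.Cons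
        length_Cons list.size(3) of_nat_Suc of_nat_0 add_0_right add_ac)
  have "{f. reduces m UNIV G f} = {\<lambda>x y. x + y, \<lambda>x y. x + y + 1}"
  proof (intro equalityI subsetI)
    fix f assume "f \<in> {f. reduces m UNIV G f}"
    then have f: "reduces m UNIV G f" by simp
    then obtain e where e: "f e e = e"
      using bit_semigroup_idempotent[of f] by (auto simp: reduces_def)
    have "f e x = x" for x
      using reduces_idempotent_prefix(1)[OF f assms(2) _ _ e] assms(1)
      by (simp add: G sum_list_replicate_bit)
    then have "f x y = e + x + y" for x y
      using reduces_idempotent_prefix(2)[OF f assms(2) _ _ e] assms
      by (simp add: foldl_add sum_list_replicate_bit add.assoc)
    then have "f = (\<lambda>x y. e + x + y)" by blast
    then show "f \<in> {\<lambda>x y. x + y, \<lambda>x y. x + y + 1}"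
      by (cases e) (auto simp: add_ac)
  next
    fix f :: "bit \<Rightarrow> bit \<Rightarrow> bit" assume "f \<in> {\<lambda>x y. x + y, \<lambda>x y. x + y + 1}"
    moreover have "reduces m UNIV G (\<lambda>x y. x + y + 1)"
      unfolding reduces_def
    proof (intro conjI ballI)
      \<comment> \<open>The fold adds the constant 1 once for each of the m - 1 steps, an even
        number, so these contributions cancel.\<close>
      fix bs :: "bit list" assume "bs \<in> tuples m UNIV"
      then obtain b bs' where "bs = b # bs'" "even (length bs')"
        using assms by (cases bs) (auto simp: tuples_def)
      then show "G bs = foldl (\<lambda>x y. x + y + 1) (hd bs) (tl bs)"
        by (auto simp: foldl_add foldl_shift elim!: evenE)
    qed (simp_all add: add_ac)
    ultimately show "f \<in> {f. reduces m UNIV G f}" using reduces_g by auto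
  qed
  then show ?thesis
    using binary_reductions_eq
    unfolding parity_congruence H_quotient_reductions_def parity_op_def by simp
qed

lemma parity_op_neq: "parity_op (\<lambda>x y. x + y) \<noteq> parity_op (\<lambda>x y. x + y + 1)"
proof
  have inj: "inj parity_class"
    using labelled_quotient.inj_c[OF parity_quotient[OF odd_one]] .
  assume "parity_op (\<lambda>x y. x + y) = parity_op (\<lambda>x y. x + y + 1)"
  \<comment> \<open>At the pair of classes with label 0 the two operations give labels 0 and
    1.\<close>
  then have "parity_op (\<lambda>x y. x + y) (parity_class 0, parity_class 0) =
      parity_op (\<lambda>x y. x + y + 1) (parity_class 0, parity_class 0)" by simp
  then show False by (simp add: parity_op_def labelled_op_apply[OF inj] inj_eq[OF inj])
qed

text \<open>Except for \<nu>, the identity of the table serves as e for every x. For \<nu> there is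
  no identity: x = 0 requires e = 0, x = 1 requires e = 1, and x = 2 admits both.\<close>

lemma cayley_reductions_five:
  "H_quotient_reductions 5 cong_nabla = {cayley_op nabla_classes [[0]]}"
  "H_quotient_reductions 5 cong_alpha = {cayley_op alpha_classes [[0, 0], [0, 1]]}"
  "H_quotient_reductions 5 cong_beta = {cayley_op beta_classes [[0, 1], [1, 1]]}"
  "H_quotient_reductions 5 cong_lambda = {cayley_op lambda_classes [[0, 1, 2], [1, 2, 1], [2, 1, 2]]}"
  "H_quotient_reductions 5 cong_mu = {cayley_op mu_classes [[2, 0, 0], [0, 1, 2], [0, 2, 2]]}"
  "H_quotient_reductions 5 cong_nu = {cayley_op nu_classes [[0, 2, 2], [2, 1, 2], [2, 2, 2]]}"
  unfolding cong_defs
  by ((rule cayley_reductions, rule cayley_quotients, simp);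
      simp add: class_defs numeral_eq_Suc All_less_Suc Ex_less_Suc)+

theorem theorem6p6:
  shows "(\<forall>m::nat. odd m \<and> m \<ge> 3 \<longrightarrow>
            quotient_critically_irreducible m X (H m) \<and>
            listed_congruences = {\<theta>. mary_congruence m X (H m) \<theta> \<and> \<theta> \<noteq> Id_on X} \<and>
            card listed_congruences = 7 \<and>
            listed_congruences //
                {(\<theta>, \<phi>). H_quotients_isomorphic m \<theta> \<phi> \<and>
                  \<theta> \<in> listed_congruences \<and>
                  \<phi> \<in> listed_congruences}
              = {{cong_nabla}, {cong_alpha, cong_beta}, {cong_pi}, {cong_lambda, cong_mu}, {cong_nu}} \<and>
            card {{cong_nabla}, {cong_alpha, cong_beta}, {cong_pi}, {cong_lambda, cong_mu}, {cong_nu}} = 5) \<and>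
         card (H_quotient_reductions 5 cong_nabla) = 1 \<and>
         card (H_quotient_reductions 5 cong_alpha) = 1 \<and>
         card (H_quotient_reductions 5 cong_pi) = 2 \<and>
         card (H_quotient_reductions 5 cong_beta) = 1 \<and>
         card (H_quotient_reductions 5 cong_lambda) = 1 \<and>
         card (H_quotient_reductions 5 cong_mu) = 1 \<and>
         card (H_quotient_reductions 5 cong_nu) = 1 \<and>
         H_quotient_reductions 5 cong_nabla = {cayley_op nabla_classes [[0]]} \<and>
         H_quotient_reductions 5 cong_alpha = {cayley_op alpha_classes [[0, 0], [0, 1]]} \<and>
         H_quotient_reductions 5 cong_pi = {parity_op (\<lambda>x y. x + y), parity_op (\<lambda>x y. x + y + 1)} \<and>
         H_quotient_reductions 5 cong_beta = {cayley_op beta_classes [[0, 1], [1, 1]]} \<and>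
         H_quotient_reductions 5 cong_lambda =
           {cayley_op lambda_classes [[0, 1, 2], [1, 2, 1], [2, 1, 2]]} \<and>
         H_quotient_reductions 5 cong_mu =
           {cayley_op mu_classes [[2, 0, 0], [0, 1, 2], [0, 2, 2]]} \<and>
         H_quotient_reductions 5 cong_nu =
           {cayley_op nu_classes [[0, 2, 2], [2, 1, 2], [2, 2, 2]]}"
proof (intro conjI allI impI)
  fix m :: nat assume "odd m \<and> m \<ge> 3"
  then have m: "odd m" "m \<ge> 3" by simp_all
  show "quotient_critically_irreducible m X (H m)"
    unfolding quotient_critically_irreducible_def
    using mary_semigroup_H[OF m(1)] H_not_reducible[OF m] congruences_H[OF m]
      listed_congruences_reducible(2)[OF m(1)] by blast
  show "listed_congruences = {\<theta>. mary_congruence m X (H m) \<theta> \<and> \<theta> \<noteq> Id_on X}"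
    using congruences_H[OF m] by simp
  show "card listed_congruences = 7"
    using distinct_card[OF listed_distinct] by (simp add: listed_congruences_def)
  \<comment> \<open>The seven relations are pairwise distinct, so the five listed sets are pairwise
    distinct too.\<close>
  show "card {{cong_nabla}, {cong_alpha, cong_beta}, {cong_pi}, {cong_lambda, cong_mu}, {cong_nu}} = 5"
    using listed_distinct
    unfolding distinct.simps list.set insert_iff empty_iff de_Morgan_disj
    by (elim conjE) (simp add: doubleton_eq_iff card_insert_if)
qed (use isomorphism_types cayley_reductions_five parity_reductions[of 5] parity_op_neq in simp_all)

end
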